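(* Let $p$ be a prime number and $n,k,s$ positive integers with $p\geq 2$, $s\geq 2$ and $n\geq (p+s-2)(k-1)+(s-1)+\max(\{p,s\})$. Then $$\chi\left(KG^{p}(n,k)_{s\text{-}stab}\right)\geq \left\lceil \frac{n-(p+s-2)(k-1)-(s-1)}{p-1}\right\rceil .$$
   Context: A $k$-subset $S\subseteq[n]$ is $s$-stable if $s\leq |i-j|\leq n-s$ for all distinct $i,j\in S$. $KG^{p}(n,k)_{s\text{-}stab}$ is the $p$-uniform hypergraph whose vertices are the $s$-stable $k$-subsets of $[n]$ and whose edges are the $p$-element sets of pairwise disjoint such subsets. A proper coloring of a hypergraph assigns colors to vertices so that no edge is monochromatic; $\chi$ is the minimum number of colors in a proper coloring. *)

theory Defs
  imports Complex_Main "HOL-Computational_Algebra.Primes"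
begin

text \<open>A hypergraph is a pair consisting of a vertex set and a set of edges.\<close>

type_synonym 'a hypergraph = "'a set \<times> 'a set set"

definition monochromatic :: "('a \<Rightarrow> 'c) \<Rightarrow> 'a set \<Rightarrow> bool" where
  "monochromatic c e \<longleftrightarrow> (\<exists>a. \<forall>v\<in>e. c v = a)"

definition proper_coloring :: "'a hypergraph \<Rightarrow> nat \<Rightarrow> ('a \<Rightarrow> nat) \<Rightarrow> bool" where
  "proper_coloring H m c \<longleftrightarrow>
     c ` fst H \<subseteq> {..<m} \<and> (\<forall>e\<in>snd H. \<not> monochromatic c e)"

text \<open>The minimum is attained for every finite hypergraph whose edges all have at least two
  vertices (see \<open>chromatic_number_attained\<close>); in other cases the value may be unspecified.\<close>

definition chromatic_number :: "'a hypergraph \<Rightarrow> nat" where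
  "chromatic_number H = (LEAST m. \<exists>c. proper_coloring H m c)"

definition stable :: "nat \<Rightarrow> nat \<Rightarrow> nat set \<Rightarrow> bool" where
  "stable n s S \<longleftrightarrow>
     (\<forall>i\<in>S. \<forall>j\<in>S. i \<noteq> j \<longrightarrow>
        int s \<le> \<bar>int i - int j\<bar> \<and> \<bar>int i - int j\<bar> \<le> int n - int s)"

definition stable_subsets :: "nat \<Rightarrow> nat \<Rightarrow> nat \<Rightarrow> nat set set" where
  "stable_subsets n k s = {S. S \<subseteq> {1..n} \<and> card S = k \<and> stable n s S}"

definition stable_kneser_hypergraph ::
    "nat \<Rightarrow> nat \<Rightarrow> nat \<Rightarrow> nat \<Rightarrow> nat set hypergraph" where
  "stable_kneser_hypergraph p n k s =
     (stable_subsets n k s,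
      {e. e \<subseteq> stable_subsets n k s \<and> card e = p \<and> pairwise disjnt e})"

lemma chromatic_number_attained:
  fixes H :: "'a hypergraph"
  assumes fin: "finite (fst H)"
    and edges: "\<And>e. e \<in> snd H \<Longrightarrow> e \<subseteq> fst H \<and> 2 \<le> card e"
  shows "\<exists>c. proper_coloring H (chromatic_number H) c"
proof -
  obtain f where f: "inj_on f (fst H)" "f ` fst H = {..<card (fst H)}"
    using ex_bij_betw_finite_nat[OF fin] by (auto simp: bij_betw_def atLeast0LessThan)
  have "\<not> monochromatic f e" if "e \<in> snd H" for e
  proof
    assume "monochromatic f e"
    then obtain a where a: "\<forall>v\<in>e. f v = a"
      by (auto simp: monochromatic_def)
    have "inj_on f e"
      using f(1) edges[OF that] inj_on_subset by blast
    then have "card e = card (f ` e)"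
      by (simp add: card_image)
    also have "\<dots> \<le> card {a}"
      using a by (intro card_mono) auto
    finally show False
      using edges[OF that] by simp
  qed
  then have "proper_coloring H (card (fst H)) f"
    using f(2) by (simp add: proper_coloring_def)
  then have "\<exists>m. \<exists>c. proper_coloring H m c"
    by blast
  then show ?thesis
    unfolding chromatic_number_def by (rule LeastI_ex)
qed

lemma chromatic_number_stable_kneser_attained:
  assumes "2 \<le> p"
  shows "\<exists>c. proper_coloring (stable_kneser_hypergraph p n k s)
               (chromatic_number (stable_kneser_hypergraph p n k s)) c"
proof (rule chromatic_number_attained)
  have "stable_subsets n k s \<subseteq> Pow {1..n}"
    by (auto simp: stable_subsets_def)
  then show "finite (fst (stable_kneser_hypergraph p n k s))"
    by (simp add: stable_kneser_hypergraph_def finite_subset)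
qed (use assms in \<open>auto simp: stable_kneser_hypergraph_def\<close>)

end

theory Submission
  imports Defs "HOL-Number_Theory.Cong"
begin

text \<open>An \<open>s\<close>-stable set in \<open>{1..n}\<close> is obtained from any set in \<open>{1..n - s + 1}\<close> whose elements are
  pairwise at distance at least \<open>s\<close>. Put \<open>l = n - s + 1\<close> and consider the families of disjoint sets
  \<open>A a \<subseteq> {1..l}\<close>, indexed by \<open>a \<in> \<int>/p\<close> and not all empty, ordered by inclusion. The \<open>\<int>/p\<close>-Tucker
  lemma says that an equivariant monotone map from this poset to \<open>N\<close> levels of \<open>p\<close> incomparable
  signs each exists only if \<open>l \<le> N\<close>. A colouring with \<open>m\<close> colours yields such a map with
  \<open>N = (k - 1) (p + s - 2) + m (p - 1)\<close>.

  If some \<open>A a\<close> contains a spaced \<open>k\<close>-set, take the largest colour of such a set and the set of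
  indices at which it occurs: by properness this is a proper subset of \<open>\<int>/p\<close>, so each colour costs
  \<open>p - 1\<close> levels. Otherwise let \<open>h < k\<close> be the largest size of a spaced set in some \<open>A a\<close>. If not all
  indices attain \<open>h\<close>, the set of those that do again costs \<open>p - 1\<close> levels. If all of them do, the
  first element \<open>L a\<close> of \<open>A a\<close> and the last possible start \<open>U a\<close> of a spaced \<open>h\<close>-set in it satisfy
  \<open>U a < L a + s\<close>, and enlarging the family can only move \<open>L\<close> down and \<open>U\<close> up. The indices \<open>b\<close> with
  \<open>U b \<ge> L a + s - 1\<close> for some \<open>a \<noteq> b\<close> form a proper subset of \<open>\<int>/p\<close>; when there are none,
  the elements of \<open>A a\<close> in the intervals from \<open>L a\<close> to \<open>U a\<close> have different residues modulo \<open>s - 1\<close>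
  for different \<open>a\<close>. A count shows that this last case costs \<open>s - 1\<close> levels.

  The Tucker lemma is proved without topology. In the poset there are chains \<open>h 0, h 1, \<dots>\<close> with
  boundary \<open>h (d - 1) - g (h (d - 1))\<close> for odd \<open>d\<close> and the sum of all rotations of \<open>h (d - 1)\<close> for
  even \<open>d\<close>, where \<open>g\<close> generates the action. There are cochains on sequences of signs, starting with
  the constant \<open>1\<close>, whose pairing with the image of \<open>h d\<close> modulo \<open>p\<close> does not depend on \<open>d\<close>, hence
  is \<open>1\<close>. If \<open>N < l\<close>, a chain of length \<open>l\<close> repeats a level and so a sign, and the
  pairing for \<open>d = l - 1\<close> vanishes.\<close>

section \<open>Cochains on lists of labels\<close>

text \<open>The simplicial coboundary, an alternating sum over deletions of one entry. The empty
  list counts as a face, so the complex is augmented.\<close>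

primrec cobd :: "('a list \<Rightarrow> int) \<Rightarrow> 'a list \<Rightarrow> int" where
  "cobd f [] = 0"
| "cobd f (x # xs) = f xs - cobd (\<lambda>ys. f (x # ys)) xs"

lemma cobd_diff: "cobd (\<lambda>xs. f xs - g xs) xs = cobd f xs - cobd g xs"
  by (induction xs arbitrary: f g) auto

lemma cobd_zero: "cobd (\<lambda>xs. 0) xs = 0"
  by (induction xs) auto

lemma cobd_sum: "cobd (\<lambda>xs. \<Sum>j\<in>A. f j xs) xs = (\<Sum>j\<in>A. cobd (f j) xs)"
  by (induction xs arbitrary: f) (auto simp: sum_subtractf)

lemma cobd_map: "cobd (\<lambda>ys. f (map h ys)) xs = cobd f (map h xs)"
proof (induction xs arbitrary: f)
  case (Cons x xs)
  show ?case using Cons[of "\<lambda>ys. f (h x # ys)"] by simp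
qed simp

lemma cobd_cobd: "cobd (cobd f) xs = 0"
  by (induction xs arbitrary: f) (auto simp: cobd_diff)

lemma cobd_dvd:
  assumes "\<And>ys. length xs = Suc (length ys) \<Longrightarrow> set ys \<subseteq> set xs \<Longrightarrow> q dvd f ys"
  shows "q dvd cobd f xs"
  using assms
proof (induction xs arbitrary: f)
  case (Cons x xs)
  have "q dvd cobd (\<lambda>ys. f (x # ys)) xs"
    by (rule Cons.IH, rule Cons.prems) auto
  moreover have "q dvd f xs"
    by (rule Cons.prems) auto
  ultimately show ?case by simp
qed simp

section \<open>Normalized cochains, prisms and cones\<close>

definition normalized :: "('a list \<Rightarrow> int) \<Rightarrow> bool" where
  "normalized f \<longleftrightarrow> (\<forall>as a bs. f (as @ a # a # bs) = 0)"

text \<open>Deleting either of two equal neighbours leaves the same list with opposite signs; every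
  other deletion keeps the repetition.\<close>

lemma normalized_cobd:
  assumes "normalized f"
  shows "normalized (cobd f)"
proof -
  have "cobd f (as @ a # a # bs) = 0" for as a bs
    using assms
  proof (induction as arbitrary: f)
    case Nil
    then have "(\<lambda>ys. f (a # a # ys)) = (\<lambda>ys. 0)"
      unfolding normalized_def by (metis append_Nil)
    then show ?case by (simp add: cobd_zero)
  next
    case (Cons x as)
    have "normalized (\<lambda>ys. f (x # ys))"
      using Cons.prems unfolding normalized_def by (metis append_Cons)
    moreover have "f (as @ a # a # bs) = 0"
      using Cons.prems unfolding normalized_def by blast
    ultimately show ?case using Cons.IH by simp
  qed
  then show ?thesis by (simp add: normalized_def)
qed

text \<open>The prism operator of algebraic topology, dualized: it gives the homotopy between the
  identity and the map induced by \<open>s\<close>.\<close>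

primrec prism :: "('a \<Rightarrow> 'a) \<Rightarrow> ('a list \<Rightarrow> int) \<Rightarrow> 'a list \<Rightarrow> int" where
  "prism s f [] = 0"
| "prism s f (x # xs) = f (x # s x # map s xs) - prism s (\<lambda>ys. f (x # ys)) xs"

lemma prism_diff: "prism s (\<lambda>xs. f xs - g xs) xs = prism s f xs - prism s g xs"
  by (induction xs arbitrary: f g) auto

lemma prism_homotopy: "prism s (cobd f) xs + cobd (prism s f) xs = f (map s xs) - f xs"
proof (induction xs arbitrary: f)
  case (Cons x xs)
  have "cobd (\<lambda>ys. prism s f (x # ys)) xs
      = cobd (\<lambda>ys. f (x # s x # ys)) (map s xs) - cobd (prism s (\<lambda>ys. f (x # ys))) xs"
    by (simp add: cobd_diff cobd_map[of "\<lambda>ys. f (x # s x # ys)"])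
  then show ?case
    using Cons[of "\<lambda>ys. f (x # ys)"] by (simp add: prism_diff)
qed simp

lemma prism_dvd:
  assumes "\<And>as b bs. xs = as @ b # bs \<Longrightarrow> q dvd f (as @ b # s b # map s bs)"
  shows "q dvd prism s f xs"
  using assms
proof (induction xs arbitrary: f)
  case (Cons x xs)
  have "q dvd prism s (\<lambda>ys. f (x # ys)) xs"
    by (rule Cons.IH) (use Cons.prems[of "x # _"] in auto)
  moreover have "q dvd f (x # s x # map s xs)"
    using Cons.prems[of "[]"] by simp
  ultimately show ?case by simp
qed simp

text \<open>The dual of a contraction in two moves: the prism carries a simplex to its image under
  \<open>s\<close>, which is then joined to the apex \<open>v\<close>.\<close>

definition cone :: "('a \<Rightarrow> 'a) \<Rightarrow> 'a \<Rightarrow> ('a list \<Rightarrow> int) \<Rightarrow> 'a list \<Rightarrow> int" where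
  "cone s v f xs = f (v # map s xs) - prism s f xs"

lemma cone_diff: "cone s v (\<lambda>xs. f xs - g xs) xs = cone s v f xs - cone s v g xs"
  by (simp add: cone_def prism_diff)

lemma cone_homotopy: "cone s v (cobd f) xs = f xs - cobd (cone s v f) xs"
  using prism_homotopy[of s f xs]
  by (simp add: cone_def[abs_def] cobd_diff cobd_map[of "\<lambda>ys. f (v # ys)"])

text \<open>The operators \<open>1 - g\<close> (odd \<open>d\<close>) and \<open>1 + g + \<dots> + g ^ (p - 1)\<close> (even \<open>d\<close>), which annihilate
  each other when \<open>g\<close> has order \<open>p\<close>.\<close>

definition transfer :: "nat \<Rightarrow> ('a \<Rightarrow> 'a) \<Rightarrow> nat \<Rightarrow> ('a list \<Rightarrow> int) \<Rightarrow> 'a list \<Rightarrow> int" where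
  "transfer p g d f xs =
     (if odd d then f xs - f (map g xs) else \<Sum>j<p. f (map (g ^^ j) xs))"

lemma transfer_diff:
  "transfer p g d (\<lambda>xs. f xs - h xs) xs = transfer p g d f xs - transfer p g d h xs"
  by (simp add: transfer_def sum_subtractf)

lemma transfer_cobd: "transfer p g d (cobd f) xs = cobd (transfer p g d f) xs"
  by (cases "odd d")
    (simp_all add: transfer_def[abs_def] cobd_diff cobd_sum cobd_map)

lemma transfer_transfer:
  assumes "map (g ^^ p) xs = xs"
  shows "transfer p g d (transfer p g (Suc d) f) xs = 0"
proof -
  define F where "F j = f (map (g ^^ j) xs)" for j
  have "(\<Sum>j<p. F (Suc j)) = (\<Sum>j<p. F j)"
    using sum.lessThan_Suc_shift[of F p] sum.lessThan_Suc[of F p] assms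
    by (simp add: F_def)
  moreover have "map g (map (g ^^ j) xs) = map (g ^^ Suc j) xs"
      "map (g ^^ j) (map g xs) = map (g ^^ Suc j) xs" for j
    by (simp_all add: funpow_swap1)
  ultimately show ?thesis
    by (simp add: transfer_def F_def sum_subtractf del: map_map funpow.simps)
qed

section \<open>Cochains on labels in Z/p\<close>

locale label_cochains =
  fixes p :: nat
  assumes p_ge_2: "2 \<le> p"
begin

definition shift :: "nat \<Rightarrow> nat" where
  "shift e = Suc e mod p"

lemma shift_funpow: "e < p \<Longrightarrow> (shift ^^ j) e = (e + j) mod p"
  by (induction j) (auto simp: shift_def mod_Suc_eq)

lemma shift_less: "shift e < p"
  using p_ge_2 by (simp add: shift_def)

lemma shift_funpow_p: "set xs \<subseteq> {..<p} \<Longrightarrow> map (shift ^^ p) xs = xs"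
  by (rule map_idI) (auto simp: shift_funpow)

lemma shift_set: "set xs \<subseteq> {..<p} \<Longrightarrow> set (map (shift ^^ j) xs) \<subseteq> {..<p}"
  using p_ge_2 by (auto simp: shift_funpow)

text \<open>Since \<open>\<int>/p\<close> acts freely on nonempty lists of labels, the kernel of \<open>transfer d\<close> modulo \<open>p\<close> is the image of
  \<open>transfer (d + 1)\<close>; this is a preimage, built from the fundamental domain of lists with head \<open>0\<close>.\<close>

definition solve :: "nat \<Rightarrow> (nat list \<Rightarrow> int) \<Rightarrow> nat list \<Rightarrow> int" where
  "solve d f xs =
     (if even d then - (\<Sum>j\<in>{p - hd xs..<p}. f (map (shift ^^ j) xs))
      else if hd xs = 0 then f xs else 0)"

lemma normalized_solve: "normalized f \<Longrightarrow> normalized (solve d f)"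
  by (auto simp: normalized_def solve_def)

text \<open>For even \<open>d\<close> and head \<open>m\<close>, \<open>solve\<close> runs over the
  rotations with heads \<open>0\<close> to \<open>m - 1\<close>, so \<open>1 - g\<close> telescopes
  to \<open>f xs\<close>; the wrap-around at \<open>m = p - 1\<close> is paid for by the orbit sum,
  which vanishes modulo \<open>p\<close>. For odd \<open>d\<close>, \<open>f\<close> is invariant
  modulo \<open>p\<close> and exactly one rotation has head \<open>0\<close>.\<close>

lemma transfer_solve:
  assumes xs: "set xs \<subseteq> {..<p}" "xs \<noteq> []"
    and closed: "\<And>ys. set ys \<subseteq> {..<p} \<Longrightarrow> length ys = length xs \<Longrightarrow> int p dvd transfer p shift d f ys"
  shows "int p dvd transfer p shift (Suc d) (solve d f) xs - f xs"
proof -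
  define F where "F j = f (map (shift ^^ j) xs)" for j
  define m where "m = hd xs"
  have m: "m < p"
    using xs by (cases xs) (auto simp: m_def)
  have Fp: "F p = F 0"
    by (simp add: F_def shift_funpow_p xs)
  have hd_shift: "hd (map (shift ^^ j) xs) = (m + j) mod p" for j
    using xs m by (simp add: hd_map m_def shift_funpow)
  show ?thesis
  proof (cases "even d")
    case True
    have map_shift: "map (shift ^^ j) (map shift xs) = map (shift ^^ Suc j) xs" for j
      by (simp add: funpow_swap1)
    have solve0: "solve d f xs = - (\<Sum>j\<in>{p - m..<p}. F j)"
      using True by (simp add: solve_def F_def m_def)
    have solve1: "solve d f (map shift xs) = - (\<Sum>j\<in>{p - (Suc m mod p)..<p}. F (Suc j))"
      using True hd_shift[of 1] map_shift by (simp add: solve_def F_def del: map_map)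
    have "int p dvd solve d f xs - solve d f (map shift xs) - f xs"
    proof (cases "Suc m = p")
      case True
      have "(\<Sum>j<p. F j) = F 0 + (\<Sum>j\<in>{1..<p}. F j)"
        using m by (simp add: lessThan_atLeast0 sum.atLeast_Suc_lessThan)
      moreover have "int p dvd (\<Sum>j<p. F j)"
        using closed[OF xs(1)] \<open>even d\<close> by (simp add: transfer_def F_def)
      moreover have "p - m = 1" using True by simp
      moreover have "F 0 = f xs" by (simp add: F_def)
      ultimately have "solve d f xs - solve d f (map shift xs) - f xs = - (\<Sum>j<p. F j)"
        using solve0 solve1 True by simp
      then show ?thesis
        using \<open>int p dvd (\<Sum>j<p. F j)\<close> by simp
    next
      case False
      then have "Suc m < p" using m by simp
      then have "(\<Sum>j\<in>{p - (Suc m mod p)..<p}. F (Suc j)) = (\<Sum>j\<in>{p - m..<Suc p}. F j)"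
        by (simp add: sum.atLeast_Suc_lessThan_Suc_shift Suc_diff_Suc flip: sum.shift_bounds_Suc_ivl)
      also have "\<dots> = (\<Sum>j\<in>{p - m..<p}. F j) + F 0"
        using Fp by simp
      finally show ?thesis
        using solve0 solve1 by (simp add: F_def)
    qed
    then show ?thesis using True by (simp add: transfer_def)
  next
    case False
    have inv: "int p dvd F j - F 0" for j
    proof (induction j)
      case (Suc j)
      have "int p dvd F j - F (Suc j)"
        using closed[OF shift_set[OF xs(1)], of j] False by (simp add: transfer_def F_def)
      then have "int p dvd (F j - F 0) - (F j - F (Suc j))"
        by (rule dvd_diff[OF Suc])
      then show ?case by simp
    qed simp
    define j0 where "j0 = (p - m) mod p"
    have j0: "j < p \<Longrightarrow> (m + j) mod p = 0 \<longleftrightarrow> j = j0" for j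
    proof -
      assume "j < p"
      then show ?thesis
        using m by (cases "m + j < p") (auto simp: j0_def mod_if)
    qed
    have "(\<Sum>j<p. solve d f (map (shift ^^ j) xs)) = (\<Sum>j<p. if j = j0 then F j else 0)"
      using False hd_shift j0 by (intro sum.cong) (auto simp: solve_def F_def)
    also have "\<dots> = F j0"
      using p_ge_2 by (simp add: j0_def)
    finally show ?thesis
      using inv[of j0] False by (simp add: transfer_def F_def)
  qed
qed

text \<open>The recursion is dual to the boundary formula for the chains \<open>h d\<close>. Cutting
  the constant \<open>1\<close> off at length \<open>1\<close> makes it normalized.\<close>

primrec label_cochain :: "nat \<Rightarrow> nat list \<Rightarrow> int" where
  "label_cochain 0 = (\<lambda>xs. if length xs = 1 then 1 else 0)"
| "label_cochain (Suc d) = cobd (solve d (label_cochain d))"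

text \<open>For \<open>d = 0\<close> the transfer adds \<open>p\<close> ones. Later, transfer
  commutes with \<open>cobd\<close> and undoes \<open>solve\<close> modulo \<open>p\<close>, which
  leaves the coboundary of the previous cocycle.\<close>

lemma label_cochain_closed:
  assumes "set xs \<subseteq> {..<p}" "length xs = Suc d"
  shows "int p dvd transfer p shift d (label_cochain d) xs"
  using assms
proof (induction d arbitrary: xs)
  case 0
  then show ?case by (simp add: transfer_def)
next
  case (Suc d)
  let ?S = "solve d (label_cochain d)"
  have "int p dvd cobd (\<lambda>ys. transfer p shift (Suc d) ?S ys - label_cochain d ys) xs"
  proof (rule cobd_dvd)
    fix ys assume ys: "length xs = Suc (length ys)" "set ys \<subseteq> set xs"
    show "int p dvd transfer p shift (Suc d) ?S ys - label_cochain d ys"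
      by (rule transfer_solve) (use ys Suc in auto)
  qed
  moreover have "cobd (label_cochain d) xs = 0"
  proof (cases d)
    case 0
    then obtain x y where "xs = [x, y]"
      using Suc.prems by (auto simp: length_Suc_conv)
    then show ?thesis using 0 by simp
  next
    case (Suc d')
    then show ?thesis by (simp add: cobd_cobd)
  qed
  ultimately show ?case
    by (simp add: cobd_diff transfer_cobd)
qed

lemma transfer_solve_label_cochain:
  assumes "set xs \<subseteq> {..<p}" "length xs = Suc d"
  shows "int p dvd transfer p shift (Suc d) (solve d (label_cochain d)) xs - label_cochain d xs"
  by (rule transfer_solve) (use assms label_cochain_closed in auto)

lemma normalized_label_cochain: "normalized (label_cochain d)"
proof (induction d)
  case 0
  show ?case by (simp add: normalized_def)
next
  case (Suc d)
  then show ?case by (simp add: normalized_cobd normalized_solve)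
qed

end

section \<open>The Tucker lemma\<close>

definition rotate_signs :: "nat \<Rightarrow> (nat \<times> nat) set \<Rightarrow> (nat \<times> nat) set" where
  "rotate_signs p X = (\<lambda>(i, a). (i, Suc a mod p)) ` X"

text \<open>Nonzero vectors with entries in Z/p or blank, encoded as graphs of partial functions so
  that extension is inclusion.\<close>

definition signed_sets :: "nat \<Rightarrow> nat \<Rightarrow> (nat \<times> nat) set set" where
  "signed_sets p n = {X. X \<noteq> {} \<and> X \<subseteq> {1..n} \<times> {..<p} \<and> single_valued X}"

context label_cochains
begin

lemma Suc_mod_cancel: "a < p \<Longrightarrow> b < p \<Longrightarrow> Suc a mod p = Suc b mod p \<Longrightarrow> a = b"
  by (auto simp: mod_Suc split: if_splits)

lemma rotate_signs_signed:
  assumes "X \<in> signed_sets p n"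
  shows "rotate_signs p X \<in> signed_sets p n"
proof -
  have X: "X \<noteq> {}" "X \<subseteq> {1..n} \<times> {..<p}" "single_valued X"
    using assms by (auto simp: signed_sets_def)
  have "rotate_signs p X \<subseteq> {1..n} \<times> {..<p}"
    using X(2) p_ge_2 by (auto simp: rotate_signs_def)
  moreover have "single_valued (rotate_signs p X)"
    unfolding rotate_signs_def
    by (rule single_valuedI) (auto dest: single_valuedD[OF X(3)])
  ultimately show ?thesis
    using X(1) by (simp add: signed_sets_def rotate_signs_def)
qed

lemma rotate_signs_mono: "X \<subseteq> Y \<Longrightarrow> rotate_signs p X \<subseteq> rotate_signs p Y"
  by (auto simp: rotate_signs_def)

lemma rotate_signs_funpow:
  "X \<subseteq> UNIV \<times> {..<p} \<Longrightarrow> (rotate_signs p ^^ j) X = (\<lambda>(i, a). (i, (a + j) mod p)) ` X"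
proof (induction j)
  case 0
  then have "(\<lambda>(i, a). (i, (a + 0) mod p)) ` X = id ` X"
    by (intro image_cong) auto
  then show ?case by simp
next
  case (Suc j)
  then show ?case
    by (auto simp: rotate_signs_def image_image case_prod_unfold mod_Suc_eq intro!: image_cong)
qed

lemma rotate_signs_funpow_p: "X \<in> signed_sets p n \<Longrightarrow> (rotate_signs p ^^ p) X = X"
proof -
  assume X: "X \<in> signed_sets p n"
  then have "(\<lambda>(i, a). (i, (a + p) mod p)) ` X = id ` X"
    by (intro image_cong) (auto simp: signed_sets_def)
  then show ?thesis
    using X rotate_signs_funpow[of X p] by (auto simp: signed_sets_def)
qed

section \<open>Chains of signed sets\<close>

definition chain :: "nat \<Rightarrow> (nat \<times> nat) set list \<Rightarrow> bool" where
  "chain n xs \<longleftrightarrow> sorted_wrt (\<subseteq>) xs \<and> set xs \<subseteq> signed_sets p n"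

lemma sorted_wrt_subset_map:
  assumes "sorted_wrt (\<subseteq>) xs" "\<And>X Y. X \<subseteq> Y \<Longrightarrow> h X \<subseteq> h Y"
  shows "sorted_wrt (\<subseteq>) (map h xs)"
  unfolding sorted_wrt_map by (rule sorted_wrt_mono_rel[OF assms(2) assms(1)])

lemma chain_rotate: "chain n xs \<Longrightarrow> chain n (map (rotate_signs p ^^ j) xs)"
proof (induction j)
  case (Suc j)
  have "chain n (map (rotate_signs p) ys)" if "chain n ys" for ys
    using that sorted_wrt_subset_map[of ys "rotate_signs p"]
    by (auto simp: chain_def rotate_signs_signed rotate_signs_mono)
  from this[OF Suc.IH[OF Suc.prems]] show ?case by (simp add: o_def)
qed simp

text \<open>Dually to \<open>cone\<close>, these functionals evaluate a cochain on the \<open>d\<close>-chain \<open>h d\<close> of the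
  complex of signed sets on \<open>{1..d + 1}\<close> obtained by coning \<open>h (d - 1) - g (h (d - 1))\<close>,
  respectively the sum of all rotations of \<open>h (d - 1)\<close>, from the apex \<open>{(d + 1, 0)}\<close>.\<close>

primrec integ :: "nat \<Rightarrow> ((nat \<times> nat) set list \<Rightarrow> int) \<Rightarrow> int" where
  "integ 0 f = f [{(1, 0)}]"
| "integ (Suc d) f = integ d (transfer p (rotate_signs p) (Suc d)
     (cone (insert (Suc (Suc d), 0)) {(Suc (Suc d), 0)} f))"

lemma integ_diff: "integ d (\<lambda>xs. f xs - g xs) = integ d f - integ d g"
proof (induction d arbitrary: f g)
  case (Suc d)
  show ?case
    by (simp add: cone_diff[abs_def] transfer_diff[abs_def] Suc)
qed simp

lemma insert_signed:
  "X \<in> signed_sets p n \<Longrightarrow> insert (Suc n, 0) X \<in> signed_sets p (Suc n)"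
  "{(Suc n, 0)} \<in> signed_sets p (Suc n)"
  using p_ge_2 by (fastforce simp: signed_sets_def single_valued_def)+

lemma signed_sets_Suc: "X \<in> signed_sets p n \<Longrightarrow> X \<in> signed_sets p (Suc n)"
  by (fastforce simp: signed_sets_def)

lemma sorted_map_insert: "sorted_wrt (\<subseteq>) xs \<Longrightarrow> sorted_wrt (\<subseteq>) (map (insert v) xs)"
  by (rule sorted_wrt_subset_map) auto

lemma chain_prism:
  assumes "chain n (as @ b # bs)"
  shows "chain (Suc n) (as @ b # insert (Suc n, 0) b # map (insert (Suc n, 0)) bs)"
  using assms unfolding chain_def
  by (auto simp: sorted_wrt_append insert_signed signed_sets_Suc sorted_map_insert)

lemma chain_cone:
  assumes "chain n xs"
  shows "chain (Suc n) ({(Suc n, 0)} # map (insert (Suc n, 0)) xs)"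
  using assms unfolding chain_def
  by (auto simp: insert_signed sorted_map_insert)

text \<open>\<open>integ d f\<close> is an integer combination of values of \<open>f\<close> on such
  chains. The case \<open>q = 0\<close> transfers vanishing.\<close>

lemma integ_dvd:
  assumes "\<And>xs. chain (Suc d) xs \<Longrightarrow> length xs = Suc d \<Longrightarrow> q dvd f xs"
  shows "q dvd integ d f"
  using assms
proof (induction d arbitrary: f)
  case 0
  have "chain 1 [{(1, 0)}]"
    using insert_signed(2)[of 0] by (simp add: chain_def)
  then show ?case using 0 by simp
next
  case (Suc d)
  let ?n = "Suc (Suc d)"
  have cone: "q dvd cone (insert (?n, 0)) {(?n, 0)} f xs"
    if "chain (Suc d) xs" "length xs = Suc d" for xs
    unfolding cone_def
  proof (intro dvd_diff prism_dvd)
    show "q dvd f ({(?n, 0)} # map (insert (?n, 0)) xs)"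
      by (rule Suc.prems) (use that chain_cone in auto)
    fix as b bs assume "xs = as @ b # bs"
    then show "q dvd f (as @ b # insert (?n, 0) b # map (insert (?n, 0)) bs)"
      using that chain_prism by (intro Suc.prems) auto
  qed
  show ?case
    unfolding integ.simps
    by (rule Suc.IH) (use cone chain_rotate[of _ _ 1] chain_rotate in
        \<open>auto simp: transfer_def intro!: dvd_diff dvd_sum\<close>)
qed

text \<open>Stokes' formula: the boundary of \<open>h (d + 1)\<close> is the transfer of
  \<open>h d\<close>. The contraction leaves a coboundary term, which induction turns into two
  consecutive transfers, and these annihilate each other.\<close>

lemma integ_cobd: "integ (Suc d) (cobd f) = integ d (transfer p (rotate_signs p) (Suc d) f)"
proof (induction d arbitrary: f)
  case 0
  \<comment> \<open>On one-entry lists \<open>cobd\<close> gives the value at the empty list, which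
    cancels in the difference over a rotation.\<close>
  show ?case
    by (simp add: cone_homotopy[abs_def] transfer_def)
next
  case (Suc d)
  let ?n = "Suc (Suc (Suc d))" and ?t = "transfer p (rotate_signs p)"
  let ?C = "cone (insert (?n, 0)) {(?n, 0)}"
  have "integ (Suc (Suc d)) (cobd f) = integ (Suc d) (?t (Suc (Suc d)) (\<lambda>xs. f xs - cobd (?C f) xs))"
    by (simp add: cone_homotopy[abs_def])
  also have "\<dots> = integ (Suc d) (?t (Suc (Suc d)) f) - integ (Suc d) (cobd (?t (Suc (Suc d)) (?C f)))"
    by (simp add: transfer_diff[abs_def] transfer_cobd[abs_def] integ_diff del: integ.simps)
  also have "integ (Suc d) (cobd (?t (Suc (Suc d)) (?C f))) =
      integ d (?t (Suc d) (?t (Suc (Suc d)) (?C f)))"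
    by (rule Suc.IH)
  also have "\<dots> = 0"
  proof -
    have "0 dvd integ d (?t (Suc d) (?t (Suc (Suc d)) (?C f)))"
    proof (rule integ_dvd)
      fix xs assume "chain (Suc d) xs"
      then have "map (rotate_signs p ^^ p) xs = xs"
        by (intro map_idI rotate_signs_funpow_p) (auto simp: chain_def)
      then show "0 dvd ?t (Suc d) (?t (Suc (Suc d)) (?C f)) xs"
        by (simp add: transfer_transfer)
    qed
    then show ?thesis by simp
  qed
  finally show ?case by simp
qed

theorem equivariant_level_map:
  fixes lev sg :: "(nat \<times> nat) set \<Rightarrow> nat"
  assumes lev_bounds: "\<And>X. X \<in> signed_sets p n \<Longrightarrow> 1 \<le> lev X \<and> lev X \<le> N"
    and sg_less: "\<And>X. X \<in> signed_sets p n \<Longrightarrow> sg X < p"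
    and sg_rot: "\<And>X. X \<in> signed_sets p n \<Longrightarrow> sg (rotate_signs p X) = Suc (sg X) mod p"
    and lev_mono: "\<And>X Y. X \<in> signed_sets p n \<Longrightarrow> Y \<in> signed_sets p n \<Longrightarrow> X \<subseteq> Y \<Longrightarrow> lev X \<le> lev Y"
    and sg_eq: "\<And>X Y. X \<in> signed_sets p n \<Longrightarrow> Y \<in> signed_sets p n \<Longrightarrow> X \<subseteq> Y \<Longrightarrow> lev X = lev Y
      \<Longrightarrow> sg X = sg Y"
  shows "n \<le> N"
proof (rule ccontr)
  assume "\<not> n \<le> N"
  then have "N < n" by simp
  have signed_le: "X \<in> signed_sets p n" if "X \<in> signed_sets p m" "m \<le> n" for X m
    using that by (fastforce simp: signed_sets_def)
  define J where "J d = integ d (\<lambda>xs. label_cochain d (map sg xs))" for d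
  \<comment> \<open>The coboundary in \<open>label_cochain (Suc d)\<close> becomes a transfer on
    chains; equivariance of \<open>sg\<close> makes it a transfer on labels, which undoes
    \<open>solve\<close> modulo \<open>p\<close>.\<close>
  have J: "int p dvd J d - 1" if "d < n" for d
    using that
  proof (induction d)
    case 0
    show ?case by (simp add: J_def)
  next
    case (Suc d)
    let ?S = "solve d (label_cochain d)"
    have "J (Suc d) = integ (Suc d) (cobd (\<lambda>xs. ?S (map sg xs)))"
      by (simp add: J_def cobd_map[abs_def] del: integ.simps)
    also have "\<dots> = integ d (transfer p (rotate_signs p) (Suc d) (\<lambda>xs. ?S (map sg xs)))"
      by (rule integ_cobd)
    finally have "J (Suc d) - J d = integ d (\<lambda>xs. transfer p (rotate_signs p) (Suc d)
        (\<lambda>xs. ?S (map sg xs)) xs - label_cochain d (map sg xs))"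
      by (simp add: J_def integ_diff)
    also have "int p dvd \<dots>"
    proof (rule integ_dvd)
      fix xs assume xs: "chain (Suc d) xs" "length xs = Suc d"
      have sg_funpow: "map sg (map (rotate_signs p ^^ j) xs) = map (shift ^^ j) (map sg xs)" for j
      proof (induction j)
        case (Suc j)
        have "sg ((rotate_signs p ^^ Suc j) X) = shift (sg ((rotate_signs p ^^ j) X))"
          if "X \<in> set xs" for X
        proof -
          have "(rotate_signs p ^^ j) X \<in> signed_sets p n"
            using chain_rotate[OF xs(1), of j] that \<open>Suc d < n\<close>
            by (intro signed_le[of _ "Suc d"]) (auto simp: chain_def)
          then show ?thesis by (simp add: sg_rot shift_def)
        qed
        then show ?case using Suc by simp
      qed simp
      have "transfer p (rotate_signs p) (Suc d) (\<lambda>xs. ?S (map sg xs)) xs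
          = transfer p shift (Suc d) ?S (map sg xs)"
        using sg_funpow sg_funpow[of 1] by (simp add: transfer_def del: map_map)
      moreover have "int p dvd transfer p shift (Suc d) ?S (map sg xs) - label_cochain d (map sg xs)"
        using xs \<open>Suc d < n\<close> sg_less
        by (intro transfer_solve_label_cochain)
          (auto simp: chain_def subset_iff intro!: sg_less signed_le[of _ "Suc d"])
      ultimately show "int p dvd transfer p (rotate_signs p) (Suc d) (\<lambda>xs. ?S (map sg xs)) xs
          - label_cochain d (map sg xs)"
        by simp
    qed
    finally show ?case
      using Suc by (metis Suc_lessD diff_add_cancel dvd_add add_diff_eq)
  qed
  obtain m where n: "n = Suc m"
    using \<open>N < n\<close> by (cases n) auto
  \<comment> \<open>Divisibility by \<open>0\<close> means vanishing. Levels growing strictly along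
    \<open>n\<close> sets would exceed \<open>N\<close>, so two neighbours share level and
    sign.\<close>
  have "0 dvd J m"
    unfolding J_def
  proof (rule integ_dvd)
    fix xs assume xs: "chain (Suc m) xs" "length xs = Suc m"
    have signed: "xs ! i \<in> signed_sets p n" if "i < n" for i
      using xs that n by (auto simp: chain_def)
    have sub: "xs ! i \<subseteq> xs ! Suc i" if "Suc i < n" for i
      using xs that n by (auto simp: chain_def sorted_wrt_iff_nth_less)
    have "\<exists>i. Suc i < n \<and> lev (xs ! i) = lev (xs ! Suc i)"
    proof (rule ccontr)
      assume none: "\<not> ?thesis"
      have "i < n \<Longrightarrow> i < lev (xs ! i)" for i
      proof (induction i)
        case 0
        then show ?case using lev_bounds[OF signed[of 0]] by simp
      next
        case (Suc i)
        then have "lev (xs ! i) < lev (xs ! Suc i)"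
          using lev_mono[OF signed signed sub, of i] none by (simp add: le_less)
        then show ?case using Suc by simp
      qed
      from this[of m] show False
        using lev_bounds[OF signed[of m]] n \<open>N < n\<close> by simp
    qed
    then obtain i where i: "Suc i < n" "lev (xs ! i) = lev (xs ! Suc i)" by blast
    then have "sg (xs ! i) = sg (xs ! Suc i)"
      by (intro sg_eq signed sub) auto
    moreover have "xs = take i xs @ xs ! i # xs ! Suc i # drop (Suc (Suc i)) xs"
      using i xs n by (simp add: Cons_nth_drop_Suc)
    ultimately have "map sg xs = map sg (take i xs) @ sg (xs ! i) # sg (xs ! i) #
        map sg (drop (Suc (Suc i)) xs)"
      by (metis (no_types, lifting) list.simps(9) map_append)
    then show "0 dvd label_cochain m (map sg xs)"
      using normalized_label_cochain[of m] by (simp add: normalized_def)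
  qed
  then have "int p dvd 1"
    using J[of m] n by (simp add: dvd_minus_iff[of "int p" 1, symmetric])
  then show False
    using p_ge_2 by (simp add: zdvd1_eq)
qed

end

section \<open>Spaced sets\<close>

definition spaced :: "nat \<Rightarrow> nat set \<Rightarrow> bool" where
  "spaced s S \<longleftrightarrow> (\<forall>i\<in>S. \<forall>j\<in>S. i < j \<longrightarrow> i + s \<le> j)"

definition width :: "nat \<Rightarrow> nat set \<Rightarrow> nat" where
  "width s A = Max (card ` {S. S \<subseteq> A \<and> spaced s S})"

definition last_start :: "nat \<Rightarrow> nat set \<Rightarrow> nat" where
  "last_start s A = Max (Min ` {S. S \<subseteq> A \<and> spaced s S \<and> card S = width s A})"

lemma spaced_subset: "spaced s S \<Longrightarrow> R \<subseteq> S \<Longrightarrow> spaced s R"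
  by (auto simp: spaced_def)

lemma width_ge: "finite A \<Longrightarrow> S \<subseteq> A \<Longrightarrow> spaced s S \<Longrightarrow> card S \<le> width s A"
  unfolding width_def by (intro Max_ge finite_imageI) auto

lemma width_attained:
  assumes "finite A"
  obtains S where "S \<subseteq> A" "spaced s S" "card S = width s A"
proof -
  have "{} \<in> {S. S \<subseteq> A \<and> spaced s S}" by (simp add: spaced_def)
  then have "width s A \<in> card ` {S. S \<subseteq> A \<and> spaced s S}"
    unfolding width_def by (intro Max_in) (use assms in auto)
  then show ?thesis using that by auto
qed

lemma width_mono: "finite B \<Longrightarrow> A \<subseteq> B \<Longrightarrow> width s A \<le> width s B"
  by (metis finite_subset order_trans width_attained width_ge)

lemma width_pos: "finite A \<Longrightarrow> A \<noteq> {} \<Longrightarrow> 0 < width s A"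
proof -
  assume "finite A" "A \<noteq> {}"
  then obtain x where "{x} \<subseteq> A" by auto
  then show ?thesis
    using width_ge[OF \<open>finite A\<close>, of "{x}" s] by (simp add: spaced_def)
qed

lemma last_start_attained:
  assumes "finite A" "A \<noteq> {}"
  obtains S where "S \<subseteq> A" "spaced s S" "card S = width s A" "S \<noteq> {}" "last_start s A = Min S"
proof -
  let ?F = "{S. S \<subseteq> A \<and> spaced s S \<and> card S = width s A}"
  obtain S where "S \<subseteq> A" "spaced s S" "card S = width s A"
    using width_attained[OF assms(1)] .
  then have "?F \<noteq> {}" by auto
  then have "last_start s A \<in> Min ` ?F"
    unfolding last_start_def by (intro Max_in) (use assms in auto)
  then obtain R where R: "R \<subseteq> A" "spaced s R" "card R = width s A" "last_start s A = Min R"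
    by auto
  then have "R \<noteq> {}" using width_pos[OF assms, of s] by auto
  with R show ?thesis using that by blast
qed

lemma last_start_ge:
  "finite A \<Longrightarrow> S \<subseteq> A \<Longrightarrow> spaced s S \<Longrightarrow> card S = width s A \<Longrightarrow> Min S \<le> last_start s A"
  unfolding last_start_def by (intro Max_ge finite_imageI) auto

lemma last_start_in: "finite A \<Longrightarrow> A \<noteq> {} \<Longrightarrow> last_start s A \<in> A"
  by (metis Min_in finite_subset last_start_attained subsetD)

text \<open>At equal width, a maximum spaced subset of \<open>A\<close> is still maximum in
  \<open>B\<close>.\<close>

lemma last_start_mono:
  assumes "finite B" "A \<subseteq> B" "A \<noteq> {}" "width s A = width s B"
  shows "last_start s A \<le> last_start s B"
proof -
  obtain S where S: "S \<subseteq> A" "spaced s S" "card S = width s A" "S \<noteq> {}" "last_start s A = Min S"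
    using last_start_attained[OF finite_subset[OF assms(2,1)] assms(3)] .
  then have "Min S \<le> last_start s B"
    using assms by (intro last_start_ge) auto
  then show ?thesis using S by simp
qed

text \<open>Otherwise \<open>Min A\<close> could be added in front of a maximum spaced
  subset.\<close>

lemma last_start_less:
  assumes "finite A" "A \<noteq> {}" "0 < s"
  shows "last_start s A < Min A + s"
proof (rule ccontr)
  assume far: "\<not> ?thesis"
  obtain S where S: "S \<subseteq> A" "spaced s S" "card S = width s A" "S \<noteq> {}" "last_start s A = Min S"
    using last_start_attained[OF assms(1,2)] .
  have "finite S" using S assms finite_subset by blast
  then have ge: "Min A + s \<le> x" if "x \<in> S" for x
    using far S(5) that by (metis Min_le leI order_trans)
  then have "spaced s (insert (Min A) S)"
    using S(2) by (fastforce simp: spaced_def)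
  moreover have "insert (Min A) S \<subseteq> A"
    using S(1) assms by auto
  ultimately have "card (insert (Min A) S) \<le> width s A"
    using width_ge[OF assms(1)] by blast
  moreover have "Min A \<notin> S" using ge assms(3) by fastforce
  ultimately show False using S \<open>finite S\<close> by simp
qed

section \<open>The level map of a colouring\<close>

locale spaced_coloring = label_cochains +
  fixes s k n m :: nat and c :: "nat set \<Rightarrow> nat"
  assumes prime_p: "prime p"
    and s_ge_2: "2 \<le> s" and k_pos: "0 < k"
    and c_less: "\<And>S. S \<subseteq> {1..n} \<Longrightarrow> spaced s S \<Longrightarrow> card S = k \<Longrightarrow> c S < m"
    and c_proper: "\<And>S q. (\<And>a. a < p \<Longrightarrow> S a \<subseteq> {1..n} \<and> spaced s (S a) \<and> card (S a) = k \<and> c (S a) = q)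
      \<Longrightarrow> \<exists>a<p. \<exists>b<p. a \<noteq> b \<and> S a \<inter> S b \<noteq> {}"
begin

text \<open>The average of \<open>F\<close> in \<open>\<int>/p\<close>; the inverse of \<open>card F\<close> exists for proper nonempty \<open>F\<close> because \<open>p\<close>
  is prime.\<close>

definition mean :: "nat set \<Rightarrow> nat" where
  "mean F = \<Sum>F * (SOME q. [card F * q = 1] (mod p)) mod p"

lemma inj_shift: "inj_on shift {..<p}"
  by (rule inj_onI) (auto simp: shift_def intro: Suc_mod_cancel)

lemma shift_image: "shift ` {..<p} = {..<p}"
  by (rule endo_inj_surj) (use inj_shift shift_less in auto)

text \<open>Shifting adds \<open>card F\<close> to the sum modulo \<open>p\<close>, which the
  inverse of \<open>card F\<close> turns into \<open>1\<close>.\<close>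

lemma mean_shift:
  assumes "F \<subset> {..<p}" "F \<noteq> {}"
  shows "mean (shift ` F) = Suc (mean F) mod p"
proof -
  have fin: "finite F" using assms finite_subset by blast
  have inj: "inj_on shift F" using assms inj_shift by (metis inj_on_subset psubset_imp_subset)
  have "0 < card F" "card F < p"
    using assms fin psubset_card_mono[OF _ assms(1)] by (auto simp: card_gt_0_iff)
  then have "coprime (card F) p"
    using prime_p by (metis coprime_commute nat_dvd_not_less prime_imp_coprime)
  then have ex: "\<exists>q. [card F * q = 1] (mod p)"
    using cong_solve_coprime_nat by auto
  define q where "q = (SOME q. [card F * q = 1] (mod p))"
  have q: "[card F * q = 1] (mod p)"
    unfolding q_def by (rule someI_ex[OF ex])
  have "\<Sum>(shift ` F) = (\<Sum>a\<in>F. Suc a mod p)"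
    unfolding sum.reindex[OF inj] by (simp add: shift_def)
  also have "[\<dots> = (\<Sum>a\<in>F. Suc a)] (mod p)"
    by (intro cong_sum) simp
  also have "(\<Sum>a\<in>F. Suc a) = \<Sum>F + card F"
    using sum_Suc[of "\<lambda>a. a" F] by simp
  finally have "[\<Sum>(shift ` F) * q = (\<Sum>F + card F) * q] (mod p)"
    by (rule cong_scalar_right)
  also have "(\<Sum>F + card F) * q = \<Sum>F * q + card F * q"
    by (simp add: algebra_simps)
  also have "[\<dots> = \<Sum>F * q + 1] (mod p)"
    using q by (intro cong_add) auto
  finally have "\<Sum>(shift ` F) * q mod p = Suc (\<Sum>F * q) mod p"
    by (simp add: cong_def)
  then show ?thesis
    using inj by (simp add: mean_def card_image q_def mod_Suc_eq)
qed

text \<open>Extracts one set of letters from a pattern. Rotation moves only second coordinates, so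
  choosing the least first coordinate is equivariant.\<close>

definition first_fibre :: "(nat \<times> nat) set \<Rightarrow> nat set" where
  "first_fibre Z = Z `` {LEAST r. r \<in> Domain Z}"

lemma first_fibre_rotate: "first_fibre (rotate_signs p Z) = shift ` first_fibre Z"
proof -
  have "Domain (rotate_signs p Z) = Domain Z"
    by (force simp: rotate_signs_def)
  then show ?thesis
    by (force simp: first_fibre_def rotate_signs_def shift_def)
qed

lemma first_fibre_nonempty: "Z \<noteq> {} \<Longrightarrow> first_fibre Z \<noteq> {}"
proof -
  assume "Z \<noteq> {}"
  then have "\<exists>r. r \<in> Domain Z" by auto
  then have "(LEAST r. r \<in> Domain Z) \<in> Domain Z" by (rule LeastI_ex)
  then show ?thesis by (auto simp: first_fibre_def)
qed

lemma first_fibre_Times: "F \<noteq> {} \<Longrightarrow> first_fibre ({0} \<times> F) = F"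
proof -
  assume "F \<noteq> {}"
  then have "Domain ({0 :: nat} \<times> F) = {0}" by auto
  moreover have "(LEAST r. r \<in> {0 :: nat}) = 0" by (rule Least_equality) auto
  ultimately show ?thesis by (auto simp: first_fibre_def)
qed

end

lemma eq_if_mod_eq:
  fixes i j q :: nat
  assumes "i mod q = j mod q" "i < j + q" "j < i + q"
  shows "i = j"
proof -
  have "x = y" if xy: "x mod q = y mod q" "y \<le> x" "x < y + q" for x y :: nat
  proof -
    have "q dvd x - y" using xy(1) mod_eq_dvd_iff_nat[OF xy(2)] by simp
    moreover have "x - y < q" using xy by linarith
    ultimately have "x - y = 0" using nat_dvd_not_less by blast
    then show ?thesis using xy(2) by simp
  qed
  from this[of i j] this[of j i] show ?thesis using assms by (cases "i \<le> j") auto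
qed

context spaced_coloring
begin

section \<open>Patterns and levels of families\<close>

definition family :: "(nat \<Rightarrow> nat set) \<Rightarrow> bool" where
  "family A \<longleftrightarrow> (\<forall>a<p. A a \<subseteq> {1..n}) \<and> (\<forall>a<p. \<forall>b<p. a \<noteq> b \<longrightarrow> A a \<inter> A b = {})
     \<and> (\<exists>a<p. A a \<noteq> {})"

definition colours :: "(nat \<Rightarrow> nat set) \<Rightarrow> nat \<Rightarrow> nat set" where
  "colours A a = c ` {S. S \<subseteq> A a \<and> spaced s S \<and> card S = k}"

definition large :: "(nat \<Rightarrow> nat set) \<Rightarrow> bool" where
  "large A \<longleftrightarrow> (\<Union>a<p. colours A a) \<noteq> {}"

definition top_colour :: "(nat \<Rightarrow> nat set) \<Rightarrow> nat" where
  "top_colour A = Max (\<Union>a<p. colours A a)"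

definition top_letters :: "(nat \<Rightarrow> nat set) \<Rightarrow> nat set" where
  "top_letters A = {a \<in> {..<p}. top_colour A \<in> colours A a}"

definition height :: "(nat \<Rightarrow> nat set) \<Rightarrow> nat" where
  "height A = Max ((\<lambda>a. width s (A a)) ` {..<p})"

definition widest :: "(nat \<Rightarrow> nat set) \<Rightarrow> nat set" where
  "widest A = {a \<in> {..<p}. width s (A a) = height A}"

definition late :: "(nat \<Rightarrow> nat set) \<Rightarrow> nat set" where
  "late A = {b \<in> {..<p}. \<exists>a\<in>{..<p}. a \<noteq> b \<and> Min (A a) + s \<le> Suc (last_start s (A b))}"

text \<open>An interval of length \<open>s - 1\<close> has both end points in \<open>A a\<close>, so working modulo \<open>s - 1\<close> merges them.
  This saves the level by which counting elements would exceed the bound.\<close>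

definition residues :: "(nat \<Rightarrow> nat set) \<Rightarrow> (nat \<times> nat) set" where
  "residues A = (\<Union>a<p. (\<lambda>i. (i mod (s - 1), a)) ` {i \<in> A a. i \<le> last_start s (A a)})"

text \<open>The data that determine the sign. The factor \<open>{0}\<close> only gives plain sets of
  letters the same type as residues.\<close>

definition pattern :: "(nat \<Rightarrow> nat set) \<Rightarrow> (nat \<times> nat) set" where
  "pattern A =
     (if large A then {0} \<times> top_letters A
      else if widest A \<noteq> {..<p} then {0} \<times> widest A
      else if late A = {} then residues A
      else {0} \<times> late A)"

text \<open>Each height owns a block of \<open>p + s - 2\<close> levels; above these, each colour
  owns \<open>p - 1\<close>. Within a height block, \<open>widest\<close> and
  \<open>residues\<close> can share a start, since the former has fewer than \<open>p\<close>
  elements and the latter between \<open>p\<close> and \<open>s - 1\<close>.\<close>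

definition base :: "(nat \<Rightarrow> nat set) \<Rightarrow> nat" where
  "base A =
     (if large A then (k - 1) * (p + s - 2) + top_colour A * (p - 1)
      else (height A - 1) * (p + s - 2) +
        (if widest A = {..<p} \<and> late A \<noteq> {} then s - 1 else 0))"

definition level :: "(nat \<Rightarrow> nat set) \<Rightarrow> nat" where
  "level A = base A + card (pattern A)"

section \<open>Equivariance under rotation of the letters\<close>

lemma collect_shift:
  assumes "\<And>a. a < p \<Longrightarrow> Q (shift a) \<longleftrightarrow> P a"
  shows "{a \<in> {..<p}. Q a} = shift ` {a \<in> {..<p}. P a}"
proof -
  have "{a \<in> {..<p}. Q a} = {a \<in> shift ` {..<p}. Q a}"
    by (simp only: shift_image)
  also have "\<dots> = shift ` {a \<in> {..<p}. P a}"
    using assms by auto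
  finally show ?thesis .
qed

lemma shift_eq_iff: "a < p \<Longrightarrow> b < p \<Longrightarrow> shift a = shift b \<longleftrightarrow> a = b"
  using inj_shift by (auto simp: inj_on_def)

lemma rotate_signs_Times: "rotate_signs p ({0} \<times> F) = {0} \<times> shift ` F"
  by (auto simp: rotate_signs_def shift_def)

context
  fixes A B :: "nat \<Rightarrow> nat set"
  assumes rot: "\<And>a. a < p \<Longrightarrow> B (shift a) = A a"
begin

lemma UN_colours_shift: "(\<Union>a<p. colours B a) = (\<Union>a<p. colours A a)"
proof -
  have "(\<Union>a\<in>shift ` {..<p}. colours B a) = (\<Union>a<p. colours A a)"
    by (simp add: colours_def rot)
  then show ?thesis by (simp only: shift_image)
qed

lemma height_shift: "height B = height A"
proof -
  have "(\<lambda>a. width s (B a)) ` shift ` {..<p} = (\<lambda>a. width s (A a)) ` {..<p}"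
    by (simp add: image_image rot)
  then show ?thesis by (simp only: height_def shift_image)
qed

lemma widest_shift: "widest B = shift ` widest A"
  unfolding widest_def by (rule collect_shift) (simp add: rot height_shift)

lemma late_shift: "late B = shift ` late A"
  unfolding late_def
proof (rule collect_shift)
  fix b assume b: "b < p"
  have "(\<exists>a\<in>shift ` {..<p}. a \<noteq> shift b \<and> Min (B a) + s \<le> Suc (last_start s (B (shift b)))) \<longleftrightarrow>
      (\<exists>a\<in>{..<p}. a \<noteq> b \<and> Min (A a) + s \<le> Suc (last_start s (A b)))"
    using b by (auto simp: rot shift_eq_iff)
  then show "(\<exists>a\<in>{..<p}. a \<noteq> shift b \<and> Min (B a) + s \<le> Suc (last_start s (B (shift b)))) \<longleftrightarrow>
      (\<exists>a\<in>{..<p}. a \<noteq> b \<and> Min (A a) + s \<le> Suc (last_start s (A b)))"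
    by (simp only: shift_image)
qed

lemma residues_shift: "residues B = rotate_signs p (residues A)"
proof -
  have "(\<Union>a\<in>shift ` {..<p}. (\<lambda>i. (i mod (s - 1), a)) ` {i \<in> B a. i \<le> last_start s (B a)})
      = rotate_signs p (residues A)"
    by (auto simp: rot residues_def rotate_signs_def shift_def[symmetric] image_UN image_image)
  then show ?thesis by (simp only: residues_def shift_image)
qed

lemma widest_shift_full: "widest B = {..<p} \<longleftrightarrow> widest A = {..<p}"
proof
  assume "widest B = {..<p}"
  then have "shift ` widest A = shift ` {..<p}"
    by (simp only: shift_image widest_shift)
  then show "widest A = {..<p}"
    by (subst (asm) inj_on_image_eq_iff[OF inj_shift]) (auto simp: widest_def)
qed (simp add: widest_shift shift_image)

lemma top_shift: "large B = large A" "top_colour B = top_colour A"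
  "top_letters B = shift ` top_letters A"
proof -
  show "large B = large A" and top: "top_colour B = top_colour A"
    by (simp_all add: large_def top_colour_def UN_colours_shift)
  show "top_letters B = shift ` top_letters A"
    unfolding top_letters_def top
    by (rule collect_shift) (simp add: colours_def rot)
qed

lemma pattern_shift: "pattern B = rotate_signs p (pattern A)"
  unfolding pattern_def top_shift widest_shift_full late_shift residues_shift
  by (simp add: rotate_signs_Times widest_shift)

end

section \<open>Sizes of patterns\<close>

lemma pattern_subset: "pattern A \<subseteq> UNIV \<times> {..<p}"
  by (auto simp: pattern_def top_letters_def widest_def late_def residues_def)

lemma finite_residues: "finite (residues A)"
proof (rule finite_subset)
  show "residues A \<subseteq> {..<s - 1} \<times> {..<p}"
    using s_ge_2 by (auto simp: residues_def)
qed simp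

lemma finite_pattern: "finite (pattern A)"
  by (simp add: pattern_def finite_residues top_letters_def widest_def late_def)

lemma family_finite: "family A \<Longrightarrow> a < p \<Longrightarrow> finite (A a)"
  unfolding family_def by (meson finite_atLeastAtMost finite_subset)

lemma width_le_height: "a < p \<Longrightarrow> width s (A a) \<le> height A"
  unfolding height_def by (intro Max_ge) auto

lemma height_attained: obtains a where "a < p" "width s (A a) = height A"
proof -
  have "height A \<in> (\<lambda>a. width s (A a)) ` {..<p}"
    unfolding height_def using p_ge_2 by (intro Max_in) (auto simp: lessThan_empty_iff)
  then show ?thesis using that by auto
qed

lemma height_pos: "family A \<Longrightarrow> 0 < height A"
  by (metis family_def family_finite less_le_trans width_le_height width_pos)

lemma widest_full_nonempty:
  assumes "family A" "widest A = {..<p}" "a < p"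
  shows "A a \<noteq> {}"
proof
  assume "A a = {}"
  then have "width s (A a) = 0"
    using width_attained[of "{}" s] by (metis card.empty finite.emptyI subset_empty)
  moreover have "width s (A a) = height A"
    using assms by (auto simp: widest_def)
  ultimately show False using height_pos[OF assms(1)] by simp
qed

lemma height_less_if_small:
  assumes "family A" "\<not> large A"
  shows "height A < k"
proof (rule ccontr)
  assume "\<not> height A < k"
  obtain a where a: "a < p" "width s (A a) = height A" using height_attained .
  obtain S where S: "S \<subseteq> A a" "spaced s S" "card S = width s (A a)"
    using width_attained[OF family_finite[OF assms(1) a(1)]] .
  then obtain R where "R \<subseteq> S" "card R = k"
    using obtain_subset_with_card_n[of k S] a \<open>\<not> height A < k\<close> by auto
  then have "c R \<in> colours A a"
    using S spaced_subset by (auto simp: colours_def)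
  then show False using assms(2) a(1) by (auto simp: large_def)
qed

text \<open>The two bounds force \<open>i\<close> and \<open>j\<close> to differ by less than
  \<open>s - 1\<close>, so equal residues would give a common element of disjoint sets.\<close>

lemma same_residue:
  assumes "family A" "a < p" "b < p" "a \<noteq> b"
    and "Suc (last_start s (A a)) < Min (A b) + s" "Suc (last_start s (A b)) < Min (A a) + s"
    and i: "i \<in> A a" "i \<le> last_start s (A a)" and j: "j \<in> A b" "j \<le> last_start s (A b)"
  shows "i mod (s - 1) \<noteq> j mod (s - 1)"
proof
  assume eq: "i mod (s - 1) = j mod (s - 1)"
  have "Min (A b) \<le> j" "Min (A a) \<le> i"
    using assms family_finite by (auto intro: Min_le)
  then have "i < j + (s - 1)" "j < i + (s - 1)"
    using assms by linarith+
  then have "i = j"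
    by (rule eq_if_mod_eq[OF eq])
  moreover have "A a \<inter> A b = {}"
    using assms(1-4) by (simp add: family_def)
  ultimately show False using i j by auto
qed

text \<open>The letter \<open>b\<close> with the least minimum is not late: by
  \<open>last_start_less\<close> a witness \<open>a\<close> would have
  \<open>Min (A a) \<le> Min (A b)\<close>, so two disjoint sets would share their minimum.\<close>

lemma late_not_full:
  assumes "family A" "widest A = {..<p}"
  shows "late A \<noteq> {..<p}"
proof
  assume full: "late A = {..<p}"
  have "Min ((\<lambda>a. Min (A a)) ` {..<p}) \<in> (\<lambda>a. Min (A a)) ` {..<p}"
    using p_ge_2 by (intro Min_in) (auto simp: lessThan_empty_iff)
  then obtain b where b: "b < p" "Min (A b) = Min ((\<lambda>a. Min (A a)) ` {..<p})" by auto
  then have least: "Min (A b) \<le> Min (A a)" if "a < p" for a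
    using that by simp
  obtain a where a: "a < p" "a \<noteq> b" "Min (A a) + s \<le> Suc (last_start s (A b))"
    using full b(1) by (auto simp: late_def)
  have ne: "finite (A x)" "A x \<noteq> {}" if "x < p" for x
    using assms that family_finite widest_full_nonempty by auto
  have "last_start s (A b) < Min (A b) + s"
    using ne[OF b(1)] s_ge_2 by (intro last_start_less) auto
  then have "Min (A a) = Min (A b)"
    using a least[OF a(1)] by linarith
  then have "Min (A a) \<in> A a \<inter> A b"
    using Min_in[OF ne[OF a(1)]] Min_in[OF ne[OF b(1)]] by simp
  moreover have "A a \<inter> A b = {}"
    using assms(1) a(1,2) b(1) by (simp add: family_def)
  ultimately show False by blast
qed

lemma not_late:
  "a < p \<Longrightarrow> b < p \<Longrightarrow> a \<noteq> b \<Longrightarrow> b \<notin> late A \<Longrightarrow> Suc (last_start s (A b)) < Min (A a) + s"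
  by (force simp: late_def)

text \<open>Minima of letters that are not late have distinct residues modulo \<open>s - 1\<close>.
  The bound ensures that the level rises even when a family passes directly from non-full
  \<open>widest\<close> to nonempty \<open>late\<close>.\<close>

lemma card_late:
  assumes "family A" "widest A = {..<p}"
  shows "p \<le> s - 1 + card (late A)"
proof -
  have ne: "Min (A x) \<in> A x" "Min (A x) \<le> last_start s (A x)" if "x < p" for x
    using that assms family_finite[of A x] widest_full_nonempty[of A x]
    by (auto intro!: Min_in Min_le last_start_in)
  have "inj_on (\<lambda>a. Min (A a) mod (s - 1)) ({..<p} - late A)"
  proof (rule inj_onI, rule ccontr)
    fix a b assume ab: "a \<in> {..<p} - late A" "b \<in> {..<p} - late A" "a \<noteq> b"
      "Min (A a) mod (s - 1) = Min (A b) mod (s - 1)"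
    then show False
      using same_residue[OF assms(1), of a b "Min (A a)" "Min (A b)"] ne not_late by auto
  qed
  then have "card ({..<p} - late A) \<le> card {..<s - 1}"
    by (rule card_inj_on_le) (use s_ge_2 in auto)
  then show ?thesis
    by (subst (asm) card_Diff_subset) (auto simp: late_def)
qed

lemma residues_unique:
  assumes "family A" "widest A = {..<p}" "late A = {}"
  shows "(r, a) \<in> residues A \<Longrightarrow> (r, b) \<in> residues A \<Longrightarrow> a = b"
  using same_residue[OF assms(1), of a b] not_late[of a b A] not_late[of b a A] assms(3)
  by (auto simp: residues_def)

text \<open>Each letter contributes the residue of its minimum, and no residue serves two
  letters.\<close>

lemma card_residues:
  assumes "family A" "widest A = {..<p}" "late A = {}"
  shows "p \<le> card (residues A)" "card (residues A) \<le> s - 1"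
proof -
  have "a \<in> snd ` residues A" if "a < p" for a
  proof -
    have "Min (A a) \<in> A a" "Min (A a) \<le> last_start s (A a)"
      using that assms family_finite[of A a] widest_full_nonempty[of A a]
      by (auto intro!: Min_in Min_le last_start_in)
    then have "(Min (A a) mod (s - 1), a) \<in> residues A"
      using that by (auto simp: residues_def)
    then show ?thesis by force
  qed
  then have "{..<p} \<subseteq> snd ` residues A" by auto
  then show "p \<le> card (residues A)"
    by (metis card_image_le card_lessThan card_mono finite_imageI finite_residues order_trans)
  have "inj_on fst (residues A)"
    by (rule inj_onI) (use residues_unique[OF assms] in auto)
  then have "card (residues A) \<le> card {..<s - 1}"
    by (rule card_inj_on_le) (use s_ge_2 in \<open>auto simp: residues_def\<close>)
  then show "card (residues A) \<le> s - 1" by simp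
qed

lemma finite_colours: "family A \<Longrightarrow> finite (\<Union>a<p. colours A a)"
  by (auto simp: colours_def family_finite)

lemma colours_less: "family A \<Longrightarrow> a < p \<Longrightarrow> q \<in> colours A a \<Longrightarrow> q < m"
proof -
  assume "family A" "a < p" "q \<in> colours A a"
  then obtain S where "q = c S" "S \<subseteq> A a" "spaced s S" "card S = k" "A a \<subseteq> {1..n}"
    by (auto simp: colours_def family_def)
  then show ?thesis using c_less[of S] by simp
qed

lemma top_colour_in: "family A \<Longrightarrow> large A \<Longrightarrow> top_colour A \<in> (\<Union>a<p. colours A a)"
  unfolding top_colour_def large_def by (rule Max_in[OF finite_colours])

text \<open>Otherwise one set of the top colour per letter would give \<open>p\<close> disjoint sets
  of one colour, against properness.\<close>

lemma top_letters_not_full: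
  assumes "family A"
  shows "top_letters A \<noteq> {..<p}"
proof
  assume full: "top_letters A = {..<p}"
  have "\<forall>a\<in>{..<p}. \<exists>S. S \<subseteq> A a \<and> spaced s S \<and> card S = k \<and> c S = top_colour A"
  proof
    fix a assume "a \<in> {..<p}"
    then have "top_colour A \<in> colours A a"
      using full unfolding top_letters_def by blast
    then obtain S where "top_colour A = c S" "S \<subseteq> A a" "spaced s S" "card S = k"
      unfolding colours_def by blast
    then show "\<exists>S. S \<subseteq> A a \<and> spaced s S \<and> card S = k \<and> c S = top_colour A"
      by metis
  qed
  then obtain S where S: "\<forall>a\<in>{..<p}. S a \<subseteq> A a \<and> spaced s (S a) \<and> card (S a) = k \<and> c (S a) = top_colour A"
    by (rule bchoice[THEN exE])
  have "\<exists>a<p. \<exists>b<p. a \<noteq> b \<and> S a \<inter> S b \<noteq> {}"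
    by (rule c_proper) (use S assms in \<open>fastforce simp: family_def\<close>)
  then show False using S assms by (fastforce simp: family_def)
qed

lemma pattern_nonempty:
  assumes "family A"
  shows "pattern A \<noteq> {}"
proof -
  have "top_letters A \<noteq> {}" if "large A"
    using top_colour_in[OF assms that] by (auto simp: top_letters_def)
  moreover have "widest A \<noteq> {}"
    using height_attained[of A] by (auto simp: widest_def)
  moreover have "residues A \<noteq> {}" if "widest A = {..<p}" "late A = {}"
    using card_residues(1)[OF assms that] p_ge_2 by auto
  ultimately show ?thesis by (auto simp: pattern_def)
qed

lemma first_fibre_pattern:
  assumes "family A"
  shows "first_fibre (pattern A) \<subset> {..<p}" "first_fibre (pattern A) \<noteq> {}"
proof -
  show "first_fibre (pattern A) \<noteq> {}"
    by (rule first_fibre_nonempty[OF pattern_nonempty[OF assms]])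
  have "first_fibre (pattern A) \<subseteq> {..<p}"
    using pattern_subset by (auto simp: first_fibre_def)
  moreover have "first_fibre (pattern A) \<noteq> {..<p}"
  proof (cases "\<not> large A \<and> widest A = {..<p} \<and> late A = {}")
    \<comment> \<open>Each residue belongs to one letter, so the fibre is a singleton, while
      \<open>p \<ge> 2\<close>.\<close>
    case True
    then have "a = b" if "a \<in> first_fibre (pattern A)" "b \<in> first_fibre (pattern A)" for a b
      using residues_unique[OF assms, of _ a b] that by (auto simp: first_fibre_def pattern_def)
    then show ?thesis
      using p_ge_2 by (metis lessThan_iff less_le_trans one_less_numeral_iff semiring_norm(76)
          zero_less_numeral zero_neq_one)
  next
    case False
    define F where "F = (if large A then top_letters A
      else if widest A \<noteq> {..<p} then widest A else late A)"
    have F: "pattern A = {0} \<times> F" "F \<noteq> {..<p}"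
      using False top_letters_not_full[OF assms] late_not_full[OF assms]
      by (auto simp: pattern_def F_def)
    moreover have "F \<noteq> {}" using pattern_nonempty[OF assms] F by auto
    ultimately show ?thesis by (simp add: first_fibre_Times)
  qed
  ultimately show "first_fibre (pattern A) \<subset> {..<p}" by blast
qed

lemma card_less_p: "F \<subset> {..<p} \<Longrightarrow> card F < p"
  using psubset_card_mono[of "{..<p}" F] by simp

lemma card_pattern_large:
  assumes "family A" "large A"
  shows "1 \<le> card (pattern A)" "card (pattern A) \<le> p - 1"
proof -
  show "1 \<le> card (pattern A)"
    using pattern_nonempty[OF assms(1)] finite_pattern by (simp add: Suc_le_eq card_gt_0_iff)
  have "top_letters A \<subset> {..<p}"
    using top_letters_not_full[OF assms(1)] by (auto simp: top_letters_def)
  then have "card (top_letters A) < p"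
    by (rule card_less_p)
  then show "card (pattern A) \<le> p - 1"
    using assms(2) by (simp add: pattern_def card_cartesian_product_singleton)
qed

text \<open>The position \<open>r\<close> inside the block of a height separates the three cases,
  which is what comparing two families of equal height requires.\<close>

lemma level_small:
  assumes "family A" "\<not> large A"
  obtains r where "level A = (height A - 1) * (p + s - 2) + r" "1 \<le> r" "r \<le> p + s - 2"
    "widest A \<noteq> {..<p} \<longrightarrow> r < p" "widest A = {..<p} \<longrightarrow> p \<le> r"
    "widest A = {..<p} \<and> late A = {} \<longrightarrow> r < s"
    "widest A = {..<p} \<and> late A \<noteq> {} \<longrightarrow> s \<le> r"
proof -
  consider "widest A \<noteq> {..<p}" | "widest A = {..<p}" "late A = {}" | "widest A = {..<p}" "late A \<noteq> {}"
    by blast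
  then show ?thesis
  proof cases
    case 1
    then have "widest A \<subset> {..<p}" by (auto simp: widest_def)
    then have "card (widest A) < p"
      by (rule card_less_p)
    moreover have "level A = (height A - 1) * (p + s - 2) + card (widest A)"
      using 1 assms by (simp add: level_def base_def pattern_def card_cartesian_product_singleton)
    moreover have "1 \<le> card (widest A)"
      using pattern_nonempty[OF assms(1)] assms 1
      by (auto simp: pattern_def Suc_le_eq card_gt_0_iff widest_def)
    ultimately show ?thesis
      using 1 s_ge_2 by (intro that[of "card (widest A)"]) auto
  next
    case 2
    then have "level A = (height A - 1) * (p + s - 2) + card (residues A)"
      using assms by (simp add: level_def base_def pattern_def card_cartesian_product_singleton)
    then show ?thesis
      using 2 s_ge_2 p_ge_2 card_residues[OF assms(1) 2]
      by (intro that[of "card (residues A)"]) auto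
  next
    case 3
    have "late A \<subset> {..<p}"
      using late_not_full[OF assms(1) 3(1)] by (auto simp: late_def)
    then have "card (late A) < p"
      by (rule card_less_p)
    moreover have "level A = (height A - 1) * (p + s - 2) + (s - 1 + card (late A))"
      using 3 assms by (simp add: level_def base_def pattern_def card_cartesian_product_singleton)
    moreover have "1 \<le> card (late A)"
      using 3 by (simp add: Suc_le_eq card_gt_0_iff late_def)
    ultimately show ?thesis
      using 3 s_ge_2 card_late[OF assms(1) 3(1)]
      by (intro that[of "s - 1 + card (late A)"]) auto
  qed
qed

lemma level_small_le:
  assumes "family A" "\<not> large A"
  shows "1 \<le> level A" "level A \<le> height A * (p + s - 2)"
    "height A * (p + s - 2) \<le> (k - 1) * (p + s - 2)"
proof -
  obtain r where r: "level A = (height A - 1) * (p + s - 2) + r" "1 \<le> r" "r \<le> p + s - 2"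
    using level_small[OF assms] .
  obtain h where h: "height A = Suc h" using height_pos[OF assms(1)] by (cases "height A") auto
  show "1 \<le> level A" "level A \<le> height A * (p + s - 2)"
    using r h by auto
  show "height A * (p + s - 2) \<le> (k - 1) * (p + s - 2)"
    using height_less_if_small[OF assms] by (intro mult_right_mono) auto
qed

lemma level_large:
  assumes "family A" "large A"
  shows "(k - 1) * (p + s - 2) + top_colour A * (p - 1) < level A"
    "level A \<le> (k - 1) * (p + s - 2) + Suc (top_colour A) * (p - 1)"
    "Suc (top_colour A) \<le> m"
proof -
  show "(k - 1) * (p + s - 2) + top_colour A * (p - 1) < level A"
    "level A \<le> (k - 1) * (p + s - 2) + Suc (top_colour A) * (p - 1)"
    using card_pattern_large[OF assms] assms by (auto simp: level_def base_def)
  show "Suc (top_colour A) \<le> m"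
    using top_colour_in[OF assms] colours_less[OF assms(1)] by (auto simp: Suc_le_eq)
qed

lemma level_bounds:
  assumes "family A"
  shows "1 \<le> level A \<and> level A \<le> (k - 1) * (p + s - 2) + m * (p - 1)"
proof (cases "large A")
  case True
  have "Suc (top_colour A) * (p - 1) \<le> m * (p - 1)"
    by (rule mult_right_mono[OF level_large(3)[OF assms True]]) simp
  then show ?thesis
    using level_large(1,2)[OF assms True] by linarith
next
  case False
  then show ?thesis
    using level_small_le[OF assms False] by linarith
qed

text \<open>Under enlargement the family either enters a higher range of levels, or keeps its base
  while its pattern grows by inclusion. In the second situation equal levels mean equal
  cardinalities, hence equal patterns and later equal signs.\<close>

lemma level_pattern_mono:
  assumes A: "family A" and B: "family B" and sub: "\<And>a. A a \<subseteq> B a"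
  shows "level A < level B \<or> level A = level B \<and> pattern A = pattern B"
proof -
  have same_base: ?thesis if "base A = base B" "pattern A \<subseteq> pattern B"
  proof (cases "pattern A = pattern B")
    case False
    then have "card (pattern A) < card (pattern B)"
      using that finite_pattern by (intro psubset_card_mono) auto
    then show ?thesis using that by (simp add: level_def)
  qed (use that in \<open>simp add: level_def\<close>)
  have colours_mono: "colours A a \<subseteq> colours B a" for a
    using sub[of a] by (auto simp: colours_def)
  then have UN_mono: "(\<Union>a<p. colours A a) \<subseteq> (\<Union>a<p. colours B a)" by blast
  have fin: "finite (B a)" "finite (A a)" if "a < p" for a
    using that family_finite A B by auto
  consider "large A" | "\<not> large A" "large B" | "\<not> large A" "\<not> large B" by blast
  then show ?thesis
  proof cases
    case 1
    then have "large B" using UN_mono by (auto simp: large_def)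
    have "top_colour A \<le> top_colour B"
      unfolding top_colour_def using UN_mono 1 finite_colours[OF B]
      by (intro Max_mono) (auto simp: large_def)
    then consider "top_colour A = top_colour B" | "Suc (top_colour A) \<le> top_colour B"
      by linarith
    then show ?thesis
    proof cases
      case 1
      then have "top_letters A \<subseteq> top_letters B"
        using colours_mono by (auto simp: top_letters_def)
      then show ?thesis
        using \<open>large A\<close> \<open>large B\<close> 1 by (intro same_base) (auto simp: base_def pattern_def)
    next
      case 2
      then have "Suc (top_colour A) * (p - 1) \<le> top_colour B * (p - 1)"
        by (rule mult_right_mono) simp
      then show ?thesis
        using level_large(2)[OF A \<open>large A\<close>] level_large(1)[OF B \<open>large B\<close>] by linarith
    qed
  next
    case 2
    then show ?thesis
      using level_small_le[OF A 2(1)] level_large(1)[OF B 2(2)] by linarith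
  next
    case 3
    obtain q where q: "level A = (height A - 1) * (p + s - 2) + q" "1 \<le> q" "q \<le> p + s - 2"
      "widest A \<noteq> {..<p} \<longrightarrow> q < p" "widest A = {..<p} \<longrightarrow> p \<le> q"
      "widest A = {..<p} \<and> late A = {} \<longrightarrow> q < s"
      "widest A = {..<p} \<and> late A \<noteq> {} \<longrightarrow> s \<le> q"
      using level_small[OF A 3(1)] .
    obtain r where r: "level B = (height B - 1) * (p + s - 2) + r" "1 \<le> r" "r \<le> p + s - 2"
      "widest B \<noteq> {..<p} \<longrightarrow> r < p" "widest B = {..<p} \<longrightarrow> p \<le> r"
      "widest B = {..<p} \<and> late B = {} \<longrightarrow> r < s"
      "widest B = {..<p} \<and> late B \<noteq> {} \<longrightarrow> s \<le> r"
      using level_small[OF B 3(2)] .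
    have w: "width s (A a) \<le> width s (B a)" if "a < p" for a
      by (rule width_mono[OF fin(1)[OF that] sub])
    obtain a where a: "a < p" "width s (A a) = height A" using height_attained .
    have "height A \<le> height B"
      using a w[OF a(1)] width_le_height[OF a(1), of B] by simp
    then consider "height A < height B" | "height A = height B" by linarith
    then show ?thesis
    proof cases
      case 1
      have "height A * (p + s - 2) \<le> (height B - 1) * (p + s - 2)"
        using 1 by (intro mult_right_mono) auto
      then show ?thesis
        using level_small_le(2)[OF A 3(1)] r by linarith
    next
      case h: 2
      have widest_mono: "widest A \<subseteq> widest B"
      proof
        fix a assume "a \<in> widest A"
        then have a: "a < p" "width s (A a) = height B" using h by (auto simp: widest_def)
        then have "width s (B a) = height B"
          using w[OF a(1)] width_le_height[OF a(1), of B] by simp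
        then show "a \<in> widest B" using a by (simp add: widest_def)
      qed
      show ?thesis
      proof (cases "widest A = {..<p}")
        case False
        show ?thesis
        proof (cases "widest B = {..<p}")
          \<comment> \<open>The bases may coincide here without inclusion of patterns; positions
            below \<open>p\<close> and at least \<open>p\<close> decide.\<close>
          case True
          then show ?thesis using q(1,4) r(1,5) False True h by simp
        next
          case F: False
          then show ?thesis
            using False 3 h widest_mono by (intro same_base) (auto simp: base_def pattern_def)
        qed
      next
        case fullA: True
        have fullB: "widest B = {..<p}"
          using widest_mono fullA by (auto simp: widest_def)
        have eq: "width s (A a) = width s (B a)" if "a < p" for a
        proof -
          have "a \<in> widest A" "a \<in> widest B" using that fullA fullB by auto
          then show ?thesis using h by (simp add: widest_def)
        qed
        have ne: "A a \<noteq> {}" if "a < p" for a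
          using widest_full_nonempty[OF A fullA that] .
        have Min_le: "Min (B a) \<le> Min (A a)" if "a < p" for a
          by (rule Min_antimono[OF sub ne[OF that] fin(1)[OF that]])
        have start_le: "last_start s (A a) \<le> last_start s (B a)" if "a < p" for a
          by (rule last_start_mono[OF fin(1)[OF that] sub ne[OF that] eq[OF that]])
        have late_mono: "late A \<subseteq> late B"
        proof
          fix b assume "b \<in> late A"
          then obtain a where ab: "b < p" "a < p" "a \<noteq> b" "Min (A a) + s \<le> Suc (last_start s (A b))"
            by (auto simp: late_def)
          then have "Min (B a) + s \<le> Suc (last_start s (B b))"
            using Min_le[OF ab(2)] start_le[OF ab(1)] by linarith
          then show "b \<in> late B" using ab by (auto simp: late_def)
        qed
        show ?thesis
        proof (cases "late A = {}")
          case lateA: True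
          show ?thesis
          proof (cases "late B = {}")
            case True
            have "residues A \<subseteq> residues B"
              unfolding residues_def using sub start_le by (fastforce intro: order_trans)
            then show ?thesis
              using True lateA 3 h fullA fullB by (intro same_base) (auto simp: base_def pattern_def)
          next
            case False
            then show ?thesis
              using q(1,6) r(1,7) fullA fullB lateA False h by simp
          qed
        next
          case False
          then have "late B \<noteq> {}" using late_mono by blast
          then show ?thesis
            using False late_mono 3 h fullA fullB by (intro same_base) (auto simp: base_def pattern_def)
        qed
      qed
    qed
  qed
qed

section \<open>Application of the Tucker lemma\<close>

theorem spaced_coloring_bound: "n \<le> (k - 1) * (p + s - 2) + m * (p - 1)"
proof -
  define fib :: "(nat \<times> nat) set \<Rightarrow> nat \<Rightarrow> nat set" where "fib X a = {i. (i, a) \<in> X}" for X a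
  have fam: "family (fib X)" if "X \<in> signed_sets p n" for X
  proof -
    have X: "X \<noteq> {}" "X \<subseteq> {1..n} \<times> {..<p}" "single_valued X"
      using that by (auto simp: signed_sets_def)
    have "fib X a \<inter> fib X b = {}" if "a \<noteq> b" for a b
      using single_valuedD[OF X(3)] that by (auto simp: fib_def)
    moreover have "fib X a \<subseteq> {1..n}" for a
      using X(2) by (auto simp: fib_def)
    moreover obtain i a where "(i, a) \<in> X" using X(1) by auto
    then have "a < p \<and> i \<in> fib X a" using X(2) by (auto simp: fib_def)
    ultimately show ?thesis unfolding family_def by blast
  qed
  have fib_rot: "fib (rotate_signs p X) (shift a) = fib X a"
    if "X \<in> signed_sets p n" "a < p" for X a
  proof -
    have "(i, shift a) \<in> rotate_signs p X \<longleftrightarrow> (i, a) \<in> X" for i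
    proof
      assume "(i, shift a) \<in> rotate_signs p X"
      then obtain b where b: "(i, b) \<in> X" "shift a = shift b"
        by (auto simp: rotate_signs_def shift_def)
      then have "b < p" using that(1) by (auto simp: signed_sets_def)
      then show "(i, a) \<in> X" using b that(2) by (simp add: shift_eq_iff)
    qed (force simp: rotate_signs_def shift_def)
    then show ?thesis by (simp add: fib_def)
  qed
  have fib_mono: "X \<subseteq> Y \<Longrightarrow> fib X a \<subseteq> fib Y a" for X Y a
    by (auto simp: fib_def)
  show ?thesis
  proof (rule equivariant_level_map[where lev = "\<lambda>X. level (fib X)"
        and sg = "\<lambda>X. mean (first_fibre (pattern (fib X)))"])
    fix X assume X: "X \<in> signed_sets p n"
    show "1 \<le> level (fib X) \<and> level (fib X) \<le> (k - 1) * (p + s - 2) + m * (p - 1)"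
      by (rule level_bounds[OF fam[OF X]])
    show "mean (first_fibre (pattern (fib X))) < p"
      using p_ge_2 by (simp add: mean_def)
    show "mean (first_fibre (pattern (fib (rotate_signs p X)))) =
        Suc (mean (first_fibre (pattern (fib X)))) mod p"
      by (simp add: pattern_shift[where A = "fib X", OF fib_rot[OF X]] first_fibre_rotate mean_shift
          first_fibre_pattern[OF fam[OF X]])
  next
    fix X Y assume XY: "X \<in> signed_sets p n" "Y \<in> signed_sets p n" "X \<subseteq> Y"
    note mono = level_pattern_mono[OF fam[OF XY(1)] fam[OF XY(2)] fib_mono[OF XY(3)]]
    show "level (fib X) \<le> level (fib Y)" using mono by auto
    show "mean (first_fibre (pattern (fib X))) = mean (first_fibre (pattern (fib Y)))"
      if "level (fib X) = level (fib Y)"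
      using mono that by auto
  qed
qed

end

section \<open>From stable sets to spaced sets\<close>

theorem theorem2p4:
  fixes p n k s :: nat
  assumes "prime p" and "n > 0" and "k > 0" and "s > 0"
    and "p \<ge> 2" and "s \<ge> 2"
    and "int n \<ge> (int p + int s - 2) * (int k - 1) + (int s - 1) + max (int p) (int s)"
  shows "int (chromatic_number (stable_kneser_hypergraph p n k s)) \<ge>
    \<lceil>(real n - (real p + real s - 2) * (real k - 1) - (real s - 1)) / (real p - 1)\<rceil>"
proof -
  define m where "m = chromatic_number (stable_kneser_hypergraph p n k s)"
  have "0 \<le> (int p + int s - 2) * (int k - 1)"
    using assms by (intro mult_nonneg_nonneg) auto
  then have "s \<le> n" using assms by linarith
  \<comment> \<open>Elements of \<open>{1..l}\<close> differ by at most
    \<open>l - 1 = n - s\<close>, the upper bound in stability; \<open>s \<le> n\<close> keeps the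
    subtraction exact.\<close>
  define l where "l = n - (s - 1)"
  have l: "l + (s - 1) = n" using \<open>s \<le> n\<close> by (simp add: l_def)
  obtain c where c: "proper_coloring (stable_kneser_hypergraph p n k s) m c"
    using chromatic_number_stable_kneser_attained[OF assms(5)] unfolding m_def by blast
  have stable: "S \<in> stable_subsets n k s" if S: "S \<subseteq> {1..l}" "spaced s S" "card S = k" for S
  proof -
    have "stable n s S"
      unfolding stable_def
    proof (intro ballI impI)
      fix i j assume ij: "i \<in> S" "j \<in> S" "i \<noteq> j"
      have "i \<le> l" "1 \<le> i" "j \<le> l" "1 \<le> j" using ij S(1) by auto
      moreover have "i + s \<le> j \<or> j + s \<le> i"
        using ij S(2) unfolding spaced_def by (metis linorder_neqE_nat)
      ultimately show "int s \<le> \<bar>int i - int j\<bar> \<and> \<bar>int i - int j\<bar> \<le> int n - int s"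
        using l assms(6) by linarith
    qed
    moreover have "S \<subseteq> {1..n}" using S(1) l by force
    ultimately show ?thesis using S(3) by (simp add: stable_subsets_def)
  qed
  interpret spaced_coloring p s k l m c
  proof
    show "2 \<le> p" "prime p" "2 \<le> s" "0 < k" using assms by auto
    show "c S < m" if "S \<subseteq> {1..l}" "spaced s S" "card S = k" for S
      using c stable[OF that] by (auto simp: proper_coloring_def stable_kneser_hypergraph_def)
    fix S :: "nat \<Rightarrow> nat set" and q
    assume S: "\<And>a. a < p \<Longrightarrow> S a \<subseteq> {1..l} \<and> spaced s (S a) \<and> card (S a) = k \<and> c (S a) = q"
    show "\<exists>a<p. \<exists>b<p. a \<noteq> b \<and> S a \<inter> S b \<noteq> {}"
    proof (rule ccontr)
      assume "\<not> ?thesis"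
      then have disj: "S a \<inter> S b = {}" if "a < p" "b < p" "a \<noteq> b" for a b
        using that by blast
      \<comment> \<open>Equal disjoint sets would be empty, contrary to \<open>k > 0\<close>; so the
        edge has exactly \<open>p\<close> members.\<close>
      have "inj_on S {..<p}"
      proof (rule inj_onI, rule ccontr)
        fix a b assume ab: "a \<in> {..<p}" "b \<in> {..<p}" "S a = S b" "a \<noteq> b"
        then have "S a = {}" using disj[of a b] by auto
        then show False using S[of a] ab assms(3) by auto
      qed
      then have "card (S ` {..<p}) = p" by (simp add: card_image)
      moreover have "pairwise disjnt (S ` {..<p})"
        using disj by (auto simp: pairwise_def disjnt_def)
      moreover have "S ` {..<p} \<subseteq> stable_subsets n k s"
        using S stable by auto
      ultimately have "S ` {..<p} \<in> snd (stable_kneser_hypergraph p n k s)"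
        by (simp add: stable_kneser_hypergraph_def)
      moreover have "monochromatic c (S ` {..<p})"
        using S by (auto simp: monochromatic_def)
      ultimately show False using c by (simp add: proper_coloring_def)
    qed
  qed
  have "real n \<le> real ((k - 1) * (p + s - 2) + m * (p - 1) + (s - 1))"
    using spaced_coloring_bound l by linarith
  also have "\<dots> = (real k - 1) * (real p + real s - 2) + real m * (real p - 1) + (real s - 1)"
    using assms by (simp add: of_nat_diff)
  finally have "real n - (real p + real s - 2) * (real k - 1) - (real s - 1) \<le> real m * (real p - 1)"
    by (simp add: mult.commute)
  then have "(real n - (real p + real s - 2) * (real k - 1) - (real s - 1)) / (real p - 1) \<le> real m"
    using assms(5) by (simp add: pos_divide_le_eq)
  then show ?thesis
    unfolding m_def[symmetric] by (simp add: ceiling_le_iff)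
qed

end
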